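(* For the Grundy numbers $\mathcal{G}(t,p)$ of one-pile restricted Nim with a pass and $\mathcal{G}(s,t,u,p)$ of three-pile restricted Nim with a pass (rule sequence $f(x)=\lceil x/2\rceil$), the following hold. (i) $\mathcal{G}(s,0,0,1)=\mathcal{G}(0,s,0,1)=\mathcal{G}(0,0,s,1)=\mathcal{G}(s,1)$ for every $s\in Z_{\ge 0}$. (ii) Let $s,t,u\in Z_{\ge 0}$ and suppose that ($s>0$ and $t>0$), or ($t>0$ and $u>0$), or ($u>0$ and $s>0$). Then: (ii.1) for any $m\in Z_{\ge 0}$, if $\mathcal{G}(s,t,u,0)=2m$, then $\mathcal{G}(s,t,u,1)=2m+1$; (ii.2) for any $m\in Z_{\ge 0}$, if $\mathcal{G}(s,t,u,0)=2m+1$, then $\mathcal{G}(s,t,u,1)=2m$.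
   Context: $Z_{\ge 0}$ is the set of non-negative integers and $N$ is the set of positive integers. For a set $S$ of non-negative integers, $\mathrm{mex}(S)$ is the smallest non-negative integer not in $S$. The Grundy number of a position $\mathbf{p}$ of an impartial game is defined recursively by $\mathcal{G}(\mathbf{p})=\mathrm{mex}(\{\mathcal{G}(\mathbf{h}):\mathbf{h}\in \mathrm{move}(\mathbf{p})\})$, where $\mathrm{move}(\mathbf{p})$ is the set of positions reachable from $\mathbf{p}$ in exactly one move. One-pile restricted Nim with a pass: positions are ordered pairs $\{t,p\}$ with $t\in Z_{\ge 0}$ (number of stones) and $p\in\{0,1\}$ ($p=1$ if the pass is still available, $p=0$ otherwise). If $p=1$ and $t>0$, then $\mathrm{move}(t,p)=\{\{t-v,p\}: v\in N,\ v\le\lceil t/2\rceil\}\cup\{\{t,0\}\}$. If $p=0$ or $t=0$, then $\mathrm{move}(t,p)=\{\{t-v,p\}: v\in N,\ v\le\lceil t/2\rceil\}$. Its Grundy number is denoted $\mathcal{G}(t,p)$. Three-pile restricted Nim with a pass: positions are ordered quadruples $\{s,t,u,p\}$ with $s,t,u\in Z_{\ge 0}$ (numbers of stones in the three piles) and $p\in\{0,1\}$ ($p=1$ if the pass is still available, $p=0$ otherwise). Let $$A(s,t,u,p)=\{\{s-v,t,u,p\}: v\in N, v\le\lceil s/2\rceil\}\cup\{\{s,t-v,u,p\}: v\in N, v\le\lceil t/2\rceil\}\cup\{\{s,t,u-v,p\}: v\in N, v\le\lceil u/2\rceil\}.$$ If $p=1$ and $s+t+u>0$, then $\mathrm{move}(s,t,u,p)=A(s,t,u,p)\cup\{\{s,t,u,0\}\}$.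 If $p=0$ or $s+t+u=0$, then $\mathrm{move}(s,t,u,p)=A(s,t,u,p)$. Its Grundy number is denoted $\mathcal{G}(s,t,u,p)$. *)

theory Defs
  imports Complex_Main
begin

definition mex :: "nat set \<Rightarrow> nat" where
  "mex S = (LEAST n. n \<notin> S)"

text \<open>An impartial game is given by the function that maps a position to the set of
  positions reachable in one move. The recursion equation (proved just below) needs
  the move relation to be well-founded.\<close>

definition grundy :: "('a \<Rightarrow> 'a set) \<Rightarrow> 'a \<Rightarrow> nat" where
  "grundy move = wfrec {(h, p). h \<in> move p} (\<lambda>g p. mex (g ` move p))"

lemma grundy_rec:
  assumes "wf {(h, p). h \<in> move p}"
  shows "grundy move p = mex {grundy move h | h. h \<in> move p}"
proof -
  have "grundy move p = mex (cut (grundy move) {(h, p). h \<in> move p} p ` move p)"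
    unfolding grundy_def by (subst wfrec[OF assms]) (rule refl)
  also have "cut (grundy move) {(h, p). h \<in> move p} p ` move p = grundy move ` move p"
    by (rule image_cong) (auto simp: cut_def)
  also have "\<dots> = {grundy move h | h. h \<in> move p}"
    by auto
  finally show ?thesis .
qed

text \<open>The maximal number of stones that may be removed from a pile of size x. As
  it never exceeds x, the subtractions below are never truncated.\<close>

definition rule_seq :: "nat \<Rightarrow> nat" where
  "rule_seq x = nat \<lceil>real x / 2\<rceil>"

lemma rule_seq_le: "rule_seq x \<le> x"
  unfolding rule_seq_def by linarith

text \<open>The last component of a position is the pass flag p: True encodes p = 1 (the pass is
  still available), False encodes p = 0.\<close>

definition nim1_removals :: "nat \<times> bool \<Rightarrow> (nat \<times> bool) set" where
  "nim1_removals = (\<lambda>(t, p). {(t - v, p) | v. 0 < v \<and> v \<le> rule_seq t})"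

definition nim1_move :: "nat \<times> bool \<Rightarrow> (nat \<times> bool) set" where
  "nim1_move = (\<lambda>(t, p).
     if p \<and> t > 0 then nim1_removals (t, p) \<union> {(t, False)} else nim1_removals (t, p))"

definition nim3_removals :: "nat \<times> nat \<times> nat \<times> bool \<Rightarrow> (nat \<times> nat \<times> nat \<times> bool) set" where
  "nim3_removals = (\<lambda>(s, t, u, p).
     {(s - v, t, u, p) | v. 0 < v \<and> v \<le> rule_seq s} \<union>
     {(s, t - v, u, p) | v. 0 < v \<and> v \<le> rule_seq t} \<union>
     {(s, t, u - v, p) | v. 0 < v \<and> v \<le> rule_seq u})"

definition nim3_move :: "nat \<times> nat \<times> nat \<times> bool \<Rightarrow> (nat \<times> nat \<times> nat \<times> bool) set" where
  "nim3_move = (\<lambda>(s, t, u, p).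
     if p \<and> s + t + u > 0 then nim3_removals (s, t, u, p) \<union> {(s, t, u, False)}
     else nim3_removals (s, t, u, p))"

lemma removal_less: "0 < v \<Longrightarrow> v \<le> rule_seq x \<Longrightarrow> x - v < x"
  using rule_seq_le[of x] by linarith

lemma rule_seq_0 [simp]: "rule_seq 0 = 0"
  by (simp add: rule_seq_def)

lemma wf_nim1_move: "wf {(h, q). h \<in> nim1_move q}"
proof (rule wf_subset)
  show "wf (measure (\<lambda>(t, p). t + of_bool p :: nat))" by simp
  show "{(h, q). h \<in> nim1_move q} \<subseteq> measure (\<lambda>(t, p). t + of_bool p :: nat)"
    by (auto simp: nim1_move_def nim1_removals_def removal_less split: if_splits)
qed

lemma wf_nim3_move: "wf {(h, q). h \<in> nim3_move q}"
proof (rule wf_subset)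
  show "wf (measure (\<lambda>(s, t, u, p). s + t + u + of_bool p :: nat))" by simp
  show "{(h, q). h \<in> nim3_move q} \<subseteq> measure (\<lambda>(s, t, u, p). s + t + u + of_bool p :: nat)"
    by (auto simp: nim3_move_def nim3_removals_def removal_less split: if_splits)
qed

definition grundy1 :: "nat \<Rightarrow> bool \<Rightarrow> nat" where
  "grundy1 t p = grundy nim1_move (t, p)"

definition grundy3 :: "nat \<Rightarrow> nat \<Rightarrow> nat \<Rightarrow> bool \<Rightarrow> nat" where
  "grundy3 s t u p = grundy nim3_move (s, t, u, p)"

end

theory Submission
  imports Defs
begin

text \<open>Write \<open>x \<oplus> 1\<close> for the number that differs from x in the lowest bit only. If the
  options of a position have the values S, then adjoining the value mex S to the values
  \<open>s \<oplus> 1\<close> with s in S gives the mex \<open>mex S \<oplus> 1\<close>. As long as no move leads to a position with at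
  most one nonempty pile, this is the induction step for (ii). The exceptions are, up to order,
  the positions (s, 1, 0). There an induction on s gives the value \<open>g s \<oplus> 1\<close> without and g s
  with the pass, where g s is the value of (s, 0, 0) without the pass; the move to (s, 0, 0)
  with the pass does no harm since g s is the value of an option of that position.\<close>

definition flip :: "nat \<Rightarrow> nat" where
  "flip x = (if even x then x + 1 else x - 1)"

lemma flip_flip [simp]: "flip (flip x) = x"
  by (auto simp: flip_def)

lemma flip_neq [simp]: "flip x \<noteq> x"
  by (auto simp: flip_def elim: oddE)

lemma flip_image_iff: "x \<in> flip ` S \<longleftrightarrow> flip x \<in> S"
  by (metis flip_flip image_iff)

text \<open>\<open>flip\<close> only exchanges the two members of each pair {2k, 2k+1}, so it can
  disturb the order of two numbers only inside one pair.\<close>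

lemma less_flipD: "x < flip y \<Longrightarrow> flip x < y \<or> x = y"
  by (cases "even x"; cases "even y") (auto simp: flip_def elim!: evenE oddE)

lemma mex_notin: "finite S \<Longrightarrow> mex S \<notin> S"
  unfolding mex_def by (rule LeastI_ex) (rule ex_new_if_finite, simp_all)

lemma less_mexD: "n < mex S \<Longrightarrow> n \<in> S"
  unfolding mex_def using not_less_Least by blast

lemma mex_eqI: "n \<notin> S \<Longrightarrow> (\<And>m. m < n \<Longrightarrow> m \<in> S) \<Longrightarrow> mex S = n"
  unfolding mex_def by (rule Least_equality) (auto simp: not_less[symmetric])

lemma mex_insert: "finite S \<Longrightarrow> a \<noteq> mex S \<Longrightarrow> mex (insert a S) = mex S"
  by (rule mex_eqI) (auto simp: mex_notin less_mexD)

text \<open>By \<open>less_flipD\<close>, a value below \<open>flip (mex S)\<close> is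
  \<open>mex S\<close> itself or the flip of a value below \<open>mex S\<close>. The inserted
  element models either the pass or the removal of a lone stone.\<close>

lemma mex_insert_flip:
  assumes "finite S"
  shows "mex (insert (mex S) (flip ` S)) = flip (mex S)"
proof (rule mex_eqI)
  show "flip (mex S) \<notin> insert (mex S) (flip ` S)"
    using assms by (simp add: flip_image_iff mex_notin)
next
  fix m assume "m < flip (mex S)"
  then show "m \<in> insert (mex S) (flip ` S)"
    using less_flipD less_mexD by (fastforce simp: flip_image_iff)
qed

text \<open>Used for permuting piles and for embedding the one-pile game: corresponding positions
  have the same set of option values by induction.\<close>

lemma grundy_transfer:
  assumes wf: "wf {(h, p). h \<in> move p}" and wf': "wf {(h, p). h \<in> move' p}"
    and move': "\<And>p. move' (\<phi> p) = \<phi> ` move p"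
  shows "grundy move' (\<phi> p) = grundy move p"
  using wf
proof (induction p rule: wf_induct_rule)
  case (less p)
  then have "grundy move' ` move' (\<phi> p) = grundy move ` move p"
    unfolding move' image_image by (intro image_cong) auto
  then show ?case
    by (simp add: grundy_rec[OF wf, of p] grundy_rec[OF wf', of "\<phi> p"] Setcompr_eq_image)
qed

text \<open>Parametrizes moves by the stones that remain; keeping \<open>f\<close> general covers
  every pile coordinate.\<close>

lemma removals_eq: "{f (x - v) | v. 0 < v \<and> v \<le> rule_seq x} = f ` {x div 2..<x}"
proof -
  have r: "rule_seq x = x - x div 2"
    unfolding rule_seq_def by linarith
  have "\<exists>v. y = x - v \<and> 0 < v \<and> v \<le> rule_seq x" if "y \<in> {x div 2..<x}" for y
    using that by (intro exI[of _ "x - y"]) (auto simp: r)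
  moreover have "x - v \<in> {x div 2..<x}" if "0 < v" "v \<le> rule_seq x" for v
    using that r by auto
  ultimately show ?thesis
    by blast
qed

lemma nim1_move_eq:
  "nim1_move (t, p) = (\<lambda>x. (x, p)) ` {t div 2..<t} \<union> (if p \<and> t > 0 then {(t, False)} else {})"
  unfolding nim1_move_def nim1_removals_def prod.case removals_eq[of "\<lambda>x. (x, p)"] by simp

lemma nim3_move_eq:
  "nim3_move (s, t, u, p) =
     (\<lambda>x. (x, t, u, p)) ` {s div 2..<s} \<union> (\<lambda>x. (s, x, u, p)) ` {t div 2..<t} \<union>
     (\<lambda>x. (s, t, x, p)) ` {u div 2..<u} \<union> (if p \<and> s + t + u > 0 then {(s, t, u, False)} else {})"
  unfolding nim3_move_def nim3_removals_def prod.case removals_eq[of "\<lambda>x. (x, t, u, p)"]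
    removals_eq[of "\<lambda>x. (s, x, u, p)"] removals_eq[of "\<lambda>x. (s, t, x, p)"] by simp

lemma grundy3_rec:
  "grundy3 s t u p = mex
     ((\<lambda>x. grundy3 x t u p) ` {s div 2..<s} \<union> (\<lambda>x. grundy3 s x u p) ` {t div 2..<t} \<union>
      (\<lambda>x. grundy3 s t x p) ` {u div 2..<u} \<union>
      (if p \<and> s + t + u > 0 then {grundy3 s t u False} else {}))"
  unfolding grundy3_def grundy_rec[OF wf_nim3_move, of "(s, t, u, p)"] Setcompr_eq_image nim3_move_eq
  by (auto simp: image_Un image_image)

lemma grundy3_swap12: "grundy3 s t u p = grundy3 t s u p"
proof -
  let ?\<phi> = "\<lambda>(s, t, u, p). (t, s, u, p) :: nat \<times> nat \<times> nat \<times> bool"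
  have "grundy nim3_move (?\<phi> (t, s, u, p)) = grundy nim3_move (t, s, u, p)"
    by (rule grundy_transfer[OF wf_nim3_move wf_nim3_move])
      (auto simp: nim3_move_eq image_Un image_image)
  then show ?thesis
    by (simp add: grundy3_def)
qed

lemma grundy3_swap23: "grundy3 s t u p = grundy3 s u t p"
proof -
  let ?\<phi> = "\<lambda>(s, t, u, p). (s, u, t, p) :: nat \<times> nat \<times> nat \<times> bool"
  have "grundy nim3_move (?\<phi> (s, u, t, p)) = grundy nim3_move (s, u, t, p)"
    by (rule grundy_transfer[OF wf_nim3_move wf_nim3_move])
      (auto simp: nim3_move_eq image_Un image_image)
  then show ?thesis
    by (simp add: grundy3_def)
qed

lemma grundy3_one_pile: "grundy3 s 0 0 p = grundy1 s p"
proof -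
  let ?\<phi> = "\<lambda>(s, p). (s, 0, 0, p) :: nat \<times> nat \<times> nat \<times> bool"
  have "grundy nim3_move (?\<phi> (s, p)) = grundy nim1_move (s, p)"
    by (rule grundy_transfer[OF wf_nim1_move wf_nim3_move])
      (auto simp: nim1_move_eq nim3_move_eq image_Un image_image)
  then show ?thesis
    by (simp add: grundy3_def grundy1_def)
qed

lemma grundy3_one_pile_rec: "grundy3 s 0 0 False = mex ((\<lambda>x. grundy3 x 0 0 False) ` {s div 2..<s})"
  by (subst grundy3_rec) simp

lemma interval_one: "{Suc 0 div 2..<Suc 0} = {0}"
  by auto

text \<open>Using the pass is itself an option, and a mex avoids the values of all options.\<close>

lemma grundy3_one_pile_pass_neq:
  assumes "s > 0"
  shows "grundy3 s 0 0 True \<noteq> grundy3 s 0 0 False"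
proof -
  let ?S = "insert (grundy3 s 0 0 False) ((\<lambda>x. grundy3 x 0 0 True) ` {s div 2..<s})"
  have "grundy3 s 0 0 True = mex ?S"
    using assms by (subst grundy3_rec) simp
  moreover have "mex ?S \<notin> ?S"
    by (rule mex_notin) simp
  ultimately show ?thesis
    by auto
qed

lemma grundy3_pile_one_no_pass: "grundy3 s 1 0 False = flip (grundy3 s 0 0 False)"
proof (induction s rule: less_induct)
  case (less s)
  let ?S = "(\<lambda>x. grundy3 x 0 0 False) ` {s div 2..<s}"
  have "(\<lambda>x. grundy3 x 1 0 False) ` {s div 2..<s} = flip ` ?S"
    using less.IH by (simp add: image_image)
  then have "grundy3 s 1 0 False = mex (insert (mex ?S) (flip ` ?S))"
    by (subst grundy3_rec) (simp add: interval_one flip: grundy3_one_pile_rec)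
  then show ?case
    using mex_insert_flip[of ?S] by (simp flip: grundy3_one_pile_rec)
qed

lemma grundy3_pile_one_pass: "s > 0 \<Longrightarrow> grundy3 s 1 0 True = grundy3 s 0 0 False"
proof (induction s rule: less_induct)
  case (less s)
  let ?S = "(\<lambda>x. grundy3 x 0 0 False) ` {s div 2..<s}"
  let ?g = "grundy3 s 0 0 False"
  have g: "?g = mex ?S"
    by (rule grundy3_one_pile_rec)
  have rec: "grundy3 s 1 0 True = mex (insert (flip ?g) (insert (grundy3 s 0 0 True)
      ((\<lambda>x. grundy3 x 1 0 True) ` {s div 2..<s})))"
    by (subst grundy3_rec)
      (simp add: interval_one grundy3_pile_one_no_pass[unfolded One_nat_def])
  show ?case
  proof (cases "s = 1")
    case False
    \<comment> \<open>No move empties the first pile, so the induction hypothesis covers all its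
      removals. The two other options do not have value \<open>?g\<close>, so they leave the mex
      unchanged.\<close>
    then have "s div 2 > 0"
      using less.prems by auto
    then have "(\<lambda>x. grundy3 x 1 0 True) ` {s div 2..<s} = ?S"
      using less.IH by (intro image_cong) auto
    then show ?thesis
      using rec grundy3_one_pile_pass_neq[OF less.prems] by (simp add: g mex_insert)
  next
    case True
    \<comment> \<open>Here a removal reaches (0, 1, 0), outside the induction hypothesis, so the
      values are computed: the options of (1, 1, 0) with the pass have values 0 and 2, giving mex
      1.\<close>
    have zero: "grundy3 0 0 0 p = 0" for p
      by (subst grundy3_rec) (simp add: mex_eqI)
    have one: "grundy3 1 0 0 False = 1"
      by (subst grundy3_rec) (simp add: interval_one zero mex_eqI)
    have "grundy3 1 0 0 True = 2"
      by (subst grundy3_rec) (auto simp: interval_one zero one[unfolded One_nat_def] intro!: mex_eqI)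
    moreover from this have "grundy3 0 1 0 True = 2"
      by (simp add: grundy3_swap12)
    ultimately show ?thesis
      using rec by (auto simp: True interval_one one[unfolded One_nat_def] flip_def intro!: mex_eqI)
  qed
qed

definition several_piles :: "nat \<Rightarrow> nat \<Rightarrow> nat \<Rightarrow> bool" where
  "several_piles s t u \<longleftrightarrow> (s > 0 \<and> t > 0) \<or> (t > 0 \<and> u > 0) \<or> (u > 0 \<and> s > 0)"

lemma grundy3_pile_one_flip:
  assumes "s > 0"
  shows "grundy3 s 1 0 True = flip (grundy3 s 1 0 False)"
  using assms by (simp add: grundy3_pile_one_pass grundy3_pile_one_no_pass del: One_nat_def)

text \<open>\<open>flip\<close> merges both parities into one equation, which suits induction on the
  total number of stones.\<close>

lemma grundy3_pass_eq_flip: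
  "several_piles s t u \<Longrightarrow> grundy3 s t u True = flip (grundy3 s t u False)"
proof (induction "s + t + u" arbitrary: s t u rule: less_induct)
  case less
  show ?case
  proof (cases "(\<forall>x\<in>{s div 2..<s}. several_piles x t u) \<and>
      (\<forall>x\<in>{t div 2..<t}. several_piles s x u) \<and> (\<forall>x\<in>{u div 2..<u}. several_piles s t x)")
    case True
    let ?S = "(\<lambda>x. grundy3 x t u False) ` {s div 2..<s} \<union> (\<lambda>x. grundy3 s x u False) ` {t div 2..<t} \<union>
      (\<lambda>x. grundy3 s t x False) ` {u div 2..<u}"
    have g: "grundy3 s t u False = mex ?S"
      by (subst grundy3_rec) simp
    have "(\<lambda>x. grundy3 x t u True) ` {s div 2..<s} =
        flip ` (\<lambda>x. grundy3 x t u False) ` {s div 2..<s}"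
      "(\<lambda>x. grundy3 s x u True) ` {t div 2..<t} =
        flip ` (\<lambda>x. grundy3 s x u False) ` {t div 2..<t}"
      "(\<lambda>x. grundy3 s t x True) ` {u div 2..<u} =
        flip ` (\<lambda>x. grundy3 s t x False) ` {u div 2..<u}"
      using True by (auto simp: image_image less.hyps intro!: image_cong)
    moreover have "s + t + u > 0"
      using less.prems by (auto simp: several_piles_def)
    \<comment> \<open>The inserted \<open>mex ?S\<close> is the value reached by passing.\<close>
    ultimately have "grundy3 s t u True = mex (insert (mex ?S) (flip ` ?S))"
      by (subst grundy3_rec) (simp add: image_Un flip: g)
    then show ?thesis
      using mex_insert_flip[of ?S] by (simp add: g)
  next
    case False
    then consider
        x where "x \<in> {s div 2..<s}" "\<not> several_piles x t u"
      | x where "x \<in> {t div 2..<t}" "\<not> several_piles s x u"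
      | x where "x \<in> {u div 2..<u}" "\<not> several_piles s t x"
      by blast
    \<comment> \<open>The offending move must empty a pile, so \<open>x = 0\<close> and that pile
      has half 0, hence size 1; exactly one other pile is nonempty.\<close>
    then have "s = 1 \<and> (t = 0) \<noteq> (u = 0) \<or> t = 1 \<and> (s = 0) \<noteq> (u = 0) \<or> u = 1 \<and> (s = 0) \<noteq> (t = 0)"
      using less.prems by cases (auto simp: several_piles_def)
    then consider "s > 0" "t = 1" "u = 0" | "s > 0" "t = 0" "u = 1" | "s = 1" "t > 0" "u = 0"
      | "s = 0" "t > 0" "u = 1" | "s = 1" "t = 0" "u > 0" | "s = 0" "t = 1" "u > 0"
      by blast
    then show ?thesis
      using grundy3_pile_one_flip[of s] grundy3_pile_one_flip[of t] grundy3_pile_one_flip[of u]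
      \<comment> \<open>As ordered rewrite rules, the swaps bring all arrangements of the piles to a
        common form.\<close>
      by cases (simp_all add: grundy3_swap12 grundy3_swap23)
  qed
qed

theorem theorem4:
  shows "(\<forall>s. grundy3 s 0 0 True = grundy1 s True \<and>
             grundy3 0 s 0 True = grundy1 s True \<and>
             grundy3 0 0 s True = grundy1 s True) \<and>
         (\<forall>s t u. (s > 0 \<and> t > 0) \<or> (t > 0 \<and> u > 0) \<or> (u > 0 \<and> s > 0) \<longrightarrow>
           (\<forall>m. grundy3 s t u False = 2 * m \<longrightarrow> grundy3 s t u True = 2 * m + 1) \<and>
           (\<forall>m. grundy3 s t u False = 2 * m + 1 \<longrightarrow> grundy3 s t u True = 2 * m))"
proof -
  have "grundy3 0 s 0 True = grundy1 s True" "grundy3 0 0 s True = grundy1 s True" for s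
    using grundy3_one_pile[of s True] by (simp_all add: grundy3_swap12 grundy3_swap23)
  then show ?thesis
    using grundy3_pass_eq_flip by (auto simp: several_piles_def grundy3_one_pile flip_def)
qed

end
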